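(* Let $N,D\ge 1$ be integers and let $$A_{2N}=\bigcup_{1\le r\le 2N}\Big[\,2\Big\lfloor \frac{2N}{r}\Big\rfloor D\,\Big]_0\times[2rD]_0\subseteq\mathbb{Z}^2 .$$ Consider the class of all exponential polynomials $$f(\xi,\eta)=\sum_{j=1}^n p_j(\xi,\eta)e^{-2\pi i(x_j\xi+y_j\eta)},\qquad (x_j,y_j)\in\mathbb{T}^2,$$ with $n\le N$ and with each $p_j\in\mathbb{C}[\xi,\eta]$ of degree $<D$. Then every $f$ in this class is determined, within the class, by its values on $A_{2N}$: if $f_1,f_2$ belong to the class and $f_1(a)=f_2(a)$ for all $a\in A_{2N}$, then $f_1=f_2$. Moreover $|A_{2N}|=O(D^2N\log N)$, i.e. there is an absolute constant $C$ with $|A_{2N}|\le C D^2N\log N$ for all $N\ge2$, $D\ge1$.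
   Context: For an integer $m\ge 0$, $[m]_0=\{0,1,\ldots,m\}$. $\mathbb{T}=\mathbb{R}/\mathbb{Z}$ is identified with $[0,1)$, so that exponential polynomials are functions on $\mathbb{R}^2$; $f_1=f_2$ means equality as functions on $\mathbb{R}^2$ (i.e. they are the same exponential polynomial). The degree of a multivariate polynomial is the highest power to which any single one of its variables is raised; so $p(\xi,\eta)$ has degree $\le d$ iff $p(\xi,\eta)=\sum_{k=0}^d p_k(\xi)\eta^k$ with each $p_k$ of degree $\le d$ (the zero polynomial is regarded as having degree less than every $D\ge1$). *)

theory Defs
  imports Complex_Main "HOL-Computational_Algebra.Polynomial"
begin

text \<open>
  Polynomials in \<open>\<complex>[\<xi>,\<eta>]\<close> are represented as \<open>complex poly poly\<close>: the coefficient of \<open>\<eta>^k\<close> is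
  the univariate polynomial \<open>p\<^sub>k(\<xi>)\<close>.
\<close>

definition poly2 :: "complex poly poly \<Rightarrow> complex \<Rightarrow> complex \<Rightarrow> complex" where
  "poly2 p \<xi> \<eta> = poly (poly p [:\<eta>:]) \<xi>"

text \<open>
  The highest power to which a single variable is raised (not the total degree). The zero
  polynomial gets the value \<open>0\<close>, so it has degree less than every \<open>D \<ge> 1\<close>.
\<close>

definition max_degree :: "complex poly poly \<Rightarrow> nat" where
  "max_degree p = Max (insert (degree p) ((\<lambda>k. degree (coeff p k)) ` {..degree p}))"

text \<open>
  The torus \<open>\<real>/\<int>\<close> is identified with \<open>[0,1)\<close>. The frequencies \<open>(x\<^sub>j,y\<^sub>j)\<close> are not required to be
  pairwise distinct.
\<close>

definition torus :: "real set" where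
  "torus = {0..<1}"

definition exp_poly ::
  "nat \<Rightarrow> (nat \<Rightarrow> complex poly poly) \<Rightarrow> (nat \<Rightarrow> real) \<Rightarrow> (nat \<Rightarrow> real) \<Rightarrow> real \<times> real \<Rightarrow> complex" where
  "exp_poly n p x y = (\<lambda>(\<xi>, \<eta>). \<Sum>j = 1..n.
     poly2 (p j) (of_real \<xi>) (of_real \<eta>) *
     exp (- 2 * of_real pi * \<i> * of_real (x j * \<xi> + y j * \<eta>)))"

definition exp_polys :: "nat \<Rightarrow> nat \<Rightarrow> (real \<times> real \<Rightarrow> complex) set" where
  "exp_polys N D = {exp_poly n p x y | n p x y.
     n \<le> N \<and> (\<forall>j\<in>{1..n}. max_degree (p j) < D \<and> (x j, y j) \<in> torus \<times> torus)}"

definition init_seg :: "nat \<Rightarrow> int set" where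
  "init_seg m = {0..int m}"

definition sampling_set :: "nat \<Rightarrow> nat \<Rightarrow> (int \<times> int) set" where
  "sampling_set M D = (\<Union>r\<in>{1..M}. init_seg (2 * (M div r) * D) \<times> init_seg (2 * r * D))"

lemma finite_sampling_set: "finite (sampling_set M D)"
  by (simp add: sampling_set_def init_seg_def)

end

theory Submission
  imports Defs "HOL-Analysis.Harmonic_Numbers" "HOL-Analysis.Complex_Transcendental"
begin

section \<open>Univariate exponential sums with polynomial coefficients\<close>

text \<open>Substituting \<open>x + 1\<close> keeps the degree and the leading coefficient; hence
  the top terms of \<open>q (x + 1)\<close> and \<open>q x\<close> can be cancelled against each
  other.\<close>

lemma coeff_shift_eq:
  fixes q :: "'a :: field_char_0 poly"
  assumes "degree q \<le> i"
  shows "coeff (pcompose q [:1, 1:]) i = coeff q i"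
proof (cases "i = degree q")
  case True
  have "degree (pcompose q [:1, 1:]) = degree q" by (simp add: degree_pcompose)
  with True show ?thesis
    using lead_coeff_comp[of "[:1, 1:]" q] by simp
next
  case False
  with assms show ?thesis
    by (simp add: coeff_eq_0 degree_pcompose)
qed

text \<open>
  Induction on the total degree bound: the operator \<open>u \<mapsto> u (n + 1) - z\<^sub>0 * u n\<close> lowers the degree
  of the coefficient of \<open>z\<^sub>0^n\<close> and multiplies the leading terms of the others by \<open>z - z\<^sub>0\<close>, while
  costing one sample.
\<close>

lemma exponential_sum_zero:
  fixes Z :: "'a :: field_char_0 set" and q :: "'a \<Rightarrow> 'a poly"
  assumes fin: "finite Z" and nz: "0 \<notin> Z"
  assumes "\<And>z i. z \<in> Z \<Longrightarrow> i \<ge> d z \<Longrightarrow> coeff (q z) i = 0"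
  assumes "\<And>n. n < (\<Sum>z\<in>Z. d z) \<Longrightarrow> (\<Sum>z\<in>Z. poly (q z) (of_nat n) * z ^ n) = 0"
  assumes "z \<in> Z"
  shows "q z = 0"
  using assms(3-5)
proof (induction "\<Sum>z\<in>Z. d z" arbitrary: d q z)
  case 0
  then have "d z = 0" using fin by simp
  with 0 show ?case by (simp add: poly_eq_iff)
next
  case (Suc m)
  from Suc.hyps(2) obtain w where w: "w \<in> Z" "d w > 0"
    by (metis Zero_not_Suc gr0I sum.neutral)
  define d' where "d' = d(w := d w - 1)"
  define q' where "q' z = smult z (pcompose (q z) [:1, 1:]) - smult w (q z)" for z
  have sum_d: "(\<Sum>z\<in>Z. d z) = Suc (\<Sum>z\<in>Z. d' z)"
    using w fin by (simp add: sum.remove[of Z w] d'_def)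
  \<comment> \<open>Truncated subtraction is harmless here: \<open>d z = 0\<close> forces
    \<open>q z = 0\<close>, which has degree 0.\<close>
  have deg: "degree (q z) \<le> i" if "z \<in> Z" "i \<ge> d z - 1" for z i
    using Suc.prems(1)[of z] that by (intro degree_le) auto
  have coeff_q': "coeff (q' z) i = (z - w) * coeff (q z) i" if "degree (q z) \<le> i" for z i
    using that by (simp add: q'_def coeff_shift_eq algebra_simps)
  have q'0: "q' z = 0" if "z \<in> Z" for z
  proof (rule Suc.hyps(1)[of d'])
    show "m = (\<Sum>z\<in>Z. d' z)" using sum_d Suc.hyps(2) by simp
    show "coeff (q' z) i = 0" if "z \<in> Z" "i \<ge> d' z" for z i
    proof (cases "z = w")
      case True
      with that deg[of z i] show ?thesis by (simp add: coeff_q' d'_def)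
    next
      case False
      with that deg[of z i] Suc.prems(1)[of z i] show ?thesis by (simp add: coeff_q' d'_def)
    qed
    show "(\<Sum>z\<in>Z. poly (q' z) (of_nat n) * z ^ n) = 0" if "n < (\<Sum>z\<in>Z. d' z)" for n
    proof -
      have "(\<Sum>z\<in>Z. poly (q' z) (of_nat n) * z ^ n) =
            (\<Sum>z\<in>Z. poly (q z) (of_nat (Suc n)) * z ^ Suc n)
              - w * (\<Sum>z\<in>Z. poly (q z) (of_nat n) * z ^ n)"
        by (simp add: q'_def poly_pcompose sum_distrib_left sum_subtractf [symmetric] algebra_simps)
      also have "\<dots> = 0"
        using Suc.prems(2)[of n] Suc.prems(2)[of "Suc n"] that sum_d by simp
      finally show ?thesis .
    qed
    show "z \<in> Z" by fact
  qed
  \<comment> \<open>\<open>z - w\<close> times the leading coefficient of \<open>q z\<close> is a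
    coefficient of \<open>q' z = 0\<close>, and \<open>z - w\<close> is nonzero.\<close>
  have others: "q z = 0" if "z \<in> Z" "z \<noteq> w" for z
    using coeff_q'[of z "degree (q z)"] q'0[of z] that by simp
  \<comment> \<open>After cancelling \<open>w\<close>, \<open>q' w = 0\<close> says only that
    \<open>q w\<close> takes equal values at \<open>n\<close> and \<open>n + 1\<close>. The sample
    at 0, where just the term of \<open>w\<close> survives, fixes this common value as 0.\<close>
  have "poly (q w) (of_nat n) = 0" for n
  proof (induction n)
    case 0
    have "(\<Sum>z\<in>Z. poly (q z) (of_nat 0) * z ^ 0) = 0"
      by (rule Suc.prems(2)) (simp add: sum_d)
    also have "(\<Sum>z\<in>Z. poly (q z) (of_nat 0) * z ^ 0) = poly (q w) (of_nat 0)"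
      using others w fin by (simp add: sum.remove[of Z w])
    finally show ?case .
  next
    case (Suc n)
    have "poly (q' w) (of_nat n) = 0" using q'0[OF w(1)] by simp
    moreover have "w \<noteq> 0" using w nz by auto
    ultimately show ?case
      using Suc by (simp add: q'_def poly_pcompose add.commute)
  qed
  then have "range of_nat \<subseteq> {x. poly (q w) x = 0}" by auto
  then have "infinite {x. poly (q w) x = 0}"
    by (metis finite_subset range_inj_infinite inj_of_nat)
  then have "q w = 0" using poly_roots_finite by blast
  with others Suc.prems(3) show ?case by blast
qed

text \<open>Transport along \<open>e\<close>, so that terms are indexed by frequencies instead of
  bases. With a uniform degree bound the number of samples becomes
  \<open>card X * D\<close>.\<close>

corollary exponential_sum_zero_inj:
  fixes e :: "'b \<Rightarrow> 'a :: field_char_0" and q :: "'b \<Rightarrow> 'a poly"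
  assumes "finite X" "inj_on e X" "\<And>x. x \<in> X \<Longrightarrow> e x \<noteq> 0"
  assumes "\<And>x i. x \<in> X \<Longrightarrow> i \<ge> D \<Longrightarrow> coeff (q x) i = 0"
  assumes "\<And>n. n < card X * D \<Longrightarrow> (\<Sum>x\<in>X. poly (q x) (of_nat n) * e x ^ n) = 0"
  assumes "x \<in> X"
  shows "q x = 0"
proof -
  have "(q \<circ> inv_into X e) (e x) = 0"
  proof (rule exponential_sum_zero[of "e ` X" "\<lambda>_. D"])
    show "(\<Sum>z\<in>e ` X. poly ((q \<circ> inv_into X e) z) (of_nat n) * z ^ n) = 0"
      if "n < (\<Sum>z\<in>e ` X. D)" for n
      using assms that by (simp add: sum.reindex card_image)
  qed (use assms in auto)
  with assms show ?thesis by simp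
qed

section \<open>Two-variable exponential sums\<close>

text \<open>Quantifying over all indices makes the bound pass to sums and differences coefficient by
  coefficient, whatever cancellation does to the actual degrees.\<close>

definition bidegree_less :: "nat \<Rightarrow> 'a :: zero poly poly \<Rightarrow> bool" where
  "bidegree_less D p \<longleftrightarrow> (\<forall>k i. k \<ge> D \<or> i \<ge> D \<longrightarrow> coeff (coeff p k) i = 0)"

lemma bidegree_less_max_degree:
  assumes "max_degree p < D"
  shows "bidegree_less D p"
proof -
  have "degree p < D" and "\<And>k. k \<le> degree p \<Longrightarrow> degree (coeff p k) < D"
    using assms by (auto simp: max_degree_def)
  then have "coeff (coeff p k) i = 0" if "k \<ge> D \<or> i \<ge> D" for k i
    using that by (cases "k \<le> degree p") (force simp: coeff_eq_0)+
  then show ?thesis by (auto simp: bidegree_less_def)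
qed

lemma bidegree_less_diff:
  fixes p q :: "'a :: ab_group_add poly poly"
  shows "bidegree_less D p \<Longrightarrow> bidegree_less D q \<Longrightarrow> bidegree_less D (p - q)"
  by (auto simp: bidegree_less_def)

lemma bidegree_less_sum:
  "(\<And>j. j \<in> A \<Longrightarrow> bidegree_less D (p j)) \<Longrightarrow> bidegree_less D (\<Sum>j\<in>A. p j)"
  by (auto simp: bidegree_less_def coeff_sum)

text \<open>Exchanges the roles of the variables: \<open>map_poly (\<lambda>c. coeff c i) p\<close>
  is the polynomial in \<eta> that multiplies the \<open>i\<close>-th power of \<xi>.\<close>

lemma coeff_poly_const:
  "coeff (poly p [:b:]) i = poly (map_poly (\<lambda>c. coeff c i) p) (b :: 'a :: comm_semiring_1)"
  by (induction p) (simp_all add: map_poly_pCons)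

text \<open>
  Among the first coordinates \<open>x\<close> of the frequencies choose one whose fibre has minimal size \<open>r\<close>.
  There are at most \<open>card S div r\<close> first coordinates, so on each row \<open>b < r * D\<close> the samples
  determine every coefficient of \<open>(e x)^a\<close>; the coefficient of the chosen \<open>x\<close> is an exponential
  sum in \<open>b\<close> with only \<open>r\<close> frequencies, hence determined by these rows.
\<close>

lemma exponential_sum2_support_empty:
  fixes S :: "('b \<times> 'b) set" and e :: "'b \<Rightarrow> complex"
  assumes fin: "finite S" and inj: "inj_on e (fst ` S \<union> snd ` S)"
    and nz: "\<And>x. x \<in> fst ` S \<union> snd ` S \<Longrightarrow> e x \<noteq> 0"
    and deg: "\<And>s. s \<in> S \<Longrightarrow> bidegree_less D (P s)"
    and P_nz: "\<And>s. s \<in> S \<Longrightarrow> P s \<noteq> 0"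
    and vanish: "\<And>r a b. 1 \<le> r \<Longrightarrow> r \<le> card S \<Longrightarrow> a < card S div r * D \<Longrightarrow> b < r * D \<Longrightarrow>
      (\<Sum>s\<in>S. poly2 (P s) (of_nat a) (of_nat b) * (e (fst s) ^ a * e (snd s) ^ b)) = 0"
  shows "S = {}"
proof (rule ccontr)
  assume "S \<noteq> {}"
  define X where "X = fst ` S"
  define Y where "Y x = {y. (x, y) \<in> S}" for x
  have S_eq: "S = Sigma X Y" by (force simp: X_def Y_def)
  have finX: "finite X" using fin by (simp add: X_def)
  have Y_sub: "Y x \<subseteq> snd ` S" for x by (force simp: Y_def)
  then have finY: "finite (Y x)" for x using fin finite_subset by blast
  have Y_ne: "Y x \<noteq> {}" if "x \<in> X" for x using that by (auto simp: X_def Y_def)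
  obtain x where x: "x \<in> X" and x_min: "\<And>x'. x' \<in> X \<Longrightarrow> card (Y x) \<le> card (Y x')"
    using \<open>S \<noteq> {}\<close> ex_has_least_nat[of "\<lambda>x. x \<in> X" _ "\<lambda>x. card (Y x)"]
    by (metis X_def ex_in_conv image_is_empty)
  define r where "r = card (Y x)"
  have r: "1 \<le> r" using Y_ne[OF x] finY[of x] by (simp add: r_def Suc_le_eq card_gt_0_iff)
  have "card X * r \<le> (\<Sum>x\<in>X. card (Y x))"
    using x_min sum_mono[of X "\<lambda>_. r" "\<lambda>x. card (Y x)"] by (simp add: r_def)
  also have "\<dots> = card S" using finX finY by (simp add: S_eq card_SigmaI)
  finally have card_le: "card X * r \<le> card S" .
  moreover have "1 \<le> card X" using x finX by (auto simp: Suc_le_eq card_gt_0_iff)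
  ultimately have "r \<le> card S"
    by (metis le_trans mult_le_mono1 nat_mult_1)
  have cX: "card X \<le> card S div r"
    using card_le r by (simp add: less_eq_div_iff_mult_less_eq)
  \<comment> \<open>Grouping \<open>S\<close> by first coordinate, \<open>Q b x\<close> is the
    polynomial in \<xi> that multiplies \<open>e x ^ a\<close> on row \<open>b\<close>.\<close>
  define Q where "Q b x = (\<Sum>y\<in>Y x. smult (e y ^ b) (poly (P (x, y)) [:of_nat b:]))" for b x
  have Q0: "Q b x' = 0" if "b < r * D" "x' \<in> X" for b x'
  proof (rule exponential_sum_zero_inj[of X e D "Q b"])
    show "inj_on e X" using inj by (rule inj_on_subset) (auto simp: X_def)
    show "coeff (Q b x) i = 0" if "x \<in> X" "D \<le> i" for x i
    proof -
      have "coeff (poly (P (x, y)) [:of_nat b:]) i = 0" if "y \<in> Y x" for y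
      proof -
        have "map_poly (\<lambda>c. coeff c i) (P (x, y)) = 0"
          using deg[of "(x, y)"] \<open>D \<le> i\<close> that
          by (auto simp: poly_eq_iff coeff_map_poly bidegree_less_def Y_def)
        then show ?thesis by (simp add: coeff_poly_const)
      qed
      then show ?thesis by (simp add: Q_def coeff_sum)
    qed
    show "(\<Sum>x\<in>X. poly (Q b x) (of_nat a) * e x ^ a) = 0" if "a < card X * D" for a
    proof -
      have "(\<Sum>x\<in>X. poly (Q b x) (of_nat a) * e x ^ a) =
        (\<Sum>x\<in>X. \<Sum>y\<in>Y x. poly2 (P (x, y)) (of_nat a) (of_nat b) * (e x ^ a * e y ^ b))"
        by (simp add: Q_def poly_sum poly2_def sum_distrib_left mult_ac)
      also have "\<dots> = (\<Sum>s\<in>S. poly2 (P s) (of_nat a) (of_nat b) * (e (fst s) ^ a * e (snd s) ^ b))"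
        using finX finY by (simp add: S_eq sum.Sigma case_prod_beta)
      also have "\<dots> = 0"
      proof (rule vanish[OF r \<open>r \<le> card S\<close> _ \<open>b < r * D\<close>])
        show "a < card S div r * D"
          using that mult_le_mono1[OF cX, of D] by linarith
      qed
      finally show ?thesis .
    qed
  qed (use finX nz that in \<open>auto simp: X_def\<close>)
  have "P (x, y) = 0" if "y \<in> Y x" for y
  proof -
    \<comment> \<open>With \<open>i\<close> fixed and \<open>b\<close> varying,
      \<open>coeff (Q b x) i\<close> is an exponential sum over the fibre \<open>Y x\<close>. It
      vanishes for \<open>b < r * D\<close>, which is the sample count that
      \<open>card (Y x) = r\<close> frequencies require.\<close>
    have "map_poly (\<lambda>c. coeff c i) (P (x, y)) = 0" for i
    proof (rule exponential_sum_zero_inj[of "Y x" e D "\<lambda>y. map_poly (\<lambda>c. coeff c i) (P (x, y))"])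
      show "inj_on e (Y x)" using inj by (rule inj_on_subset) (use Y_sub in auto)
      show "e y \<noteq> 0" if "y \<in> Y x" for y using nz that Y_sub by blast
      show "coeff (map_poly (\<lambda>c. coeff c i) (P (x, y))) k = 0" if "y \<in> Y x" "D \<le> k" for y k
        using deg[of "(x, y)"] that by (auto simp: coeff_map_poly bidegree_less_def Y_def)
      show "(\<Sum>y\<in>Y x. poly (map_poly (\<lambda>c. coeff c i) (P (x, y))) (of_nat b) * e y ^ b) = 0"
        if "b < card (Y x) * D" for b
      proof -
        have "(\<Sum>y\<in>Y x. poly (map_poly (\<lambda>c. coeff c i) (P (x, y))) (of_nat b) * e y ^ b) =
              coeff (Q b x) i"
          by (simp add: Q_def coeff_sum coeff_poly_const mult_ac)
        then show ?thesis using Q0[of b x] that x by (simp add: r_def)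
      qed
    qed (use finY that in auto)
    then show ?thesis
      by (metis (no_types, lifting) coeff_map_poly coeff_0 poly_eqI)
  qed
  moreover obtain y where "y \<in> Y x" using Y_ne[OF x] by blast
  ultimately show False using P_nz[of "(x, y)"] by (auto simp: Y_def)
qed

section \<open>Exponential polynomials on the torus\<close>

definition unit_char :: "real \<Rightarrow> complex" where
  "unit_char t = exp (- 2 * of_real pi * \<i> * of_real t)"

text \<open>Equal values force an integer difference, and two points of \<open>[0,1)\<close> differ
  by less than 1.\<close>

lemma inj_on_unit_char: "inj_on unit_char torus"
proof (rule inj_onI)
  fix s t assume st: "s \<in> torus" "t \<in> torus" and eq: "unit_char s = unit_char t"
  from eq obtain n :: int where
    n: "- 2 * of_real pi * \<i> * of_real s = - 2 * of_real pi * \<i> * of_real t + of_real (of_int (2 * n) * pi) * \<i>"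
    unfolding unit_char_def exp_eq by blast
  have "- 2 * pi * s = - 2 * pi * t + 2 * of_int n * pi"
    using arg_cong[OF n, of Im] by simp
  then have "2 * pi * (t - s) = 2 * pi * of_int n" by (simp add: algebra_simps)
  then have "t - s = of_int n" by simp
  moreover have "\<bar>t - s\<bar> < 1" using st by (auto simp: torus_def)
  ultimately have "n = 0" by linarith
  with \<open>t - s = of_int n\<close> show "s = t" by simp
qed

lemma unit_char_add: "unit_char (s + t) = unit_char s * unit_char t"
  by (simp add: unit_char_def exp_add [symmetric] algebra_simps)

lemma unit_char_mult_of_nat: "unit_char (t * of_nat n) = unit_char t ^ n"
  by (simp add: unit_char_def exp_of_nat_mult [symmetric] algebra_simps)

lemma poly2_diff: "poly2 (p - q) \<xi> \<eta> = poly2 p \<xi> \<eta> - poly2 q \<xi> \<eta>"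
  by (simp add: poly2_def)

lemma poly2_sum: "poly2 (\<Sum>j\<in>A. p j) \<xi> \<eta> = (\<Sum>j\<in>A. poly2 (p j) \<xi> \<eta>)"
  by (simp add: poly2_def poly_sum)

text \<open>Collects the polynomials of coinciding frequencies. Making \<open>P\<close> vanish off
  \<open>S\<close> allows two such representations to be compared on the union of their
  supports.\<close>

lemma exp_polys_merged:
  assumes "f \<in> exp_polys N D"
  obtains S P where "finite S" "card S \<le> N" "S \<subseteq> torus \<times> torus"
    "\<And>s. bidegree_less D (P s)" "\<And>s. s \<notin> S \<Longrightarrow> P s = 0"
    "\<And>\<xi> \<eta>. f (\<xi>, \<eta>) =
      (\<Sum>s\<in>S. poly2 (P s) (of_real \<xi>) (of_real \<eta>) * unit_char (fst s * \<xi> + snd s * \<eta>))"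
proof -
  from assms obtain n p x y where f: "f = exp_poly n p x y" and n: "n \<le> N"
    and p: "\<And>j. j \<in> {1..n} \<Longrightarrow> max_degree (p j) < D"
    and xy: "\<And>j. j \<in> {1..n} \<Longrightarrow> (x j, y j) \<in> torus \<times> torus"
    by (auto simp: exp_polys_def)
  define S where "S = (\<lambda>j. (x j, y j)) ` {1..n}"
  define P where "P s = (\<Sum>j | j \<in> {1..n} \<and> (x j, y j) = s. p j)" for s
  show ?thesis
  proof (rule that[of S P])
    show "card S \<le> N"
      using card_image_le[of "{1..n}" "\<lambda>j. (x j, y j)"] n by (simp add: S_def)
    show "S \<subseteq> torus \<times> torus" using xy by (auto simp: S_def)
    show "bidegree_less D (P s)" for s
      unfolding P_def by (intro bidegree_less_sum bidegree_less_max_degree p) auto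
    show "P s = 0" if "s \<notin> S" for s
      unfolding P_def by (rule sum.neutral) (use that in \<open>auto simp: S_def\<close>)
    show "f (\<xi>, \<eta>) =
        (\<Sum>s\<in>S. poly2 (P s) (of_real \<xi>) (of_real \<eta>) * unit_char (fst s * \<xi> + snd s * \<eta>))" for \<xi> \<eta>
    proof -
      let ?g = "\<lambda>j. poly2 (p j) (of_real \<xi>) (of_real \<eta>) * unit_char (x j * \<xi> + y j * \<eta>)"
      have "f (\<xi>, \<eta>) = (\<Sum>j\<in>{1..n}. ?g j)"
        by (simp add: f exp_poly_def unit_char_def)
      also have "\<dots> = (\<Sum>s\<in>S. \<Sum>j | j \<in> {1..n} \<and> (x j, y j) = s. ?g j)"
        unfolding S_def by (rule sum.image_gen) simp
      also have "\<dots> = (\<Sum>s\<in>S. poly2 (P s) (of_real \<xi>) (of_real \<eta>) * unit_char (fst s * \<xi> + snd s * \<eta>))"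
        by (intro sum.cong refl) (auto simp: P_def poly2_sum sum_distrib_right intro!: sum.cong)
      finally show ?thesis .
    qed
  qed (simp add: S_def)
qed

text \<open>The difference of two members has at most \<open>2 * N\<close> frequencies, which
  explains the index of the sampling set; uniqueness becomes emptiness of its support.\<close>

lemma exp_polys_determined:
  assumes f1: "f1 \<in> exp_polys N D" and f2: "f2 \<in> exp_polys N D"
    and eq: "\<And>a b. (a, b) \<in> sampling_set (2 * N) D \<Longrightarrow>
      f1 (real_of_int a, real_of_int b) = f2 (real_of_int a, real_of_int b)"
  shows "f1 = f2"
proof -
  obtain S1 P1 where 1: "finite S1" "card S1 \<le> N" "S1 \<subseteq> torus \<times> torus"
    "\<And>s. bidegree_less D (P1 s)" "\<And>s. s \<notin> S1 \<Longrightarrow> P1 s = 0"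
    "\<And>\<xi> \<eta>. f1 (\<xi>, \<eta>) =
      (\<Sum>s\<in>S1. poly2 (P1 s) (of_real \<xi>) (of_real \<eta>) * unit_char (fst s * \<xi> + snd s * \<eta>))"
    by (rule exp_polys_merged[OF f1]) (rule that)
  obtain S2 P2 where 2: "finite S2" "card S2 \<le> N" "S2 \<subseteq> torus \<times> torus"
    "\<And>s. bidegree_less D (P2 s)" "\<And>s. s \<notin> S2 \<Longrightarrow> P2 s = 0"
    "\<And>\<xi> \<eta>. f2 (\<xi>, \<eta>) =
      (\<Sum>s\<in>S2. poly2 (P2 s) (of_real \<xi>) (of_real \<eta>) * unit_char (fst s * \<xi> + snd s * \<eta>))"
    by (rule exp_polys_merged[OF f2]) (rule that)
  define P where "P s = P1 s - P2 s" for s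
  \<comment> \<open>Frequencies whose polynomials cancel are discarded, so that every remaining
    \<open>P s\<close> is nonzero.\<close>
  define S where "S = {s \<in> S1 \<union> S2. P s \<noteq> 0}"
  have fin: "finite S" using 1 2 by (simp add: S_def)
  have "card S \<le> card (S1 \<union> S2)" using 1 2 by (intro card_mono) (auto simp: S_def)
  also have "\<dots> \<le> card S1 + card S2" by (rule card_Un_le)
  finally have card: "card S \<le> 2 * N" using 1 2 by linarith
  have sub: "S \<subseteq> torus \<times> torus" using 1 2 by (auto simp: S_def)
  have diff: "f1 (\<xi>, \<eta>) - f2 (\<xi>, \<eta>) =
      (\<Sum>s\<in>S. poly2 (P s) (of_real \<xi>) (of_real \<eta>) * unit_char (fst s * \<xi> + snd s * \<eta>))" for \<xi> \<eta>
  proof -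
    let ?t = "\<lambda>P s. poly2 (P s) (of_real \<xi>) (of_real \<eta>) * unit_char (fst s * \<xi> + snd s * \<eta>)"
    have poly2_0: "poly2 0 a b = 0" for a b by (simp add: poly2_def)
    have "f1 (\<xi>, \<eta>) = (\<Sum>s\<in>S1 \<union> S2. ?t P1 s)"
      unfolding 1(6) using 1 2 by (intro sum.mono_neutral_left) (auto simp: poly2_0)
    moreover have "f2 (\<xi>, \<eta>) = (\<Sum>s\<in>S1 \<union> S2. ?t P2 s)"
      unfolding 2(6) using 1 2 by (intro sum.mono_neutral_left) (auto simp: poly2_0)
    ultimately have "f1 (\<xi>, \<eta>) - f2 (\<xi>, \<eta>) = (\<Sum>s\<in>S1 \<union> S2. ?t P s)"
      by (simp add: P_def poly2_diff sum_subtractf [symmetric] left_diff_distrib)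
    also have "\<dots> = (\<Sum>s\<in>S. ?t P s)"
      using 1 2 by (intro sum.mono_neutral_right) (auto simp: S_def poly2_0)
    finally show ?thesis .
  qed
  have "S = {}"
  proof (rule exponential_sum2_support_empty[of S unit_char D P])
    show "inj_on unit_char (fst ` S \<union> snd ` S)"
      using inj_on_unit_char by (rule inj_on_subset) (use sub in auto)
    show "bidegree_less D (P s)" for s
      using 1 2 by (simp add: P_def bidegree_less_diff)
    show "(\<Sum>s\<in>S. poly2 (P s) (of_nat a) (of_nat b) *
        (unit_char (fst s) ^ a * unit_char (snd s) ^ b)) = 0"
      if "1 \<le> r" "r \<le> card S" "a < card S div r * D" "b < r * D" for r a b
    proof -
      \<comment> \<open>Division by \<open>r\<close> is monotone in the numerator, so the samples
        wanted for \<open>card S\<close> frequencies lie in the box of index \<open>r\<close> built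
        for \<open>2 * N\<close>.\<close>
      have "card S div r * D \<le> 2 * (2 * N div r) * D"
        using div_le_mono[OF card, of r] by (intro mult_le_mono1) linarith
      then have "a \<le> 2 * (2 * N div r) * D" and "b \<le> 2 * r * D"
        using that by linarith+
      moreover have "r \<in> {1..2 * N}" using that card by simp
      ultimately have "(int a, int b) \<in> sampling_set (2 * N) D"
        unfolding sampling_set_def init_seg_def
        by (intro UN_I[of r]) (simp_all del: of_nat_mult)
      from eq[OF this] have "f1 (real a, real b) - f2 (real a, real b) = 0" by simp
      then show ?thesis
        unfolding diff by (simp add: unit_char_add unit_char_mult_of_nat)
    qed
  qed (use fin in \<open>auto simp: S_def unit_char_def\<close>)
  then show "f1 = f2" using diff by (intro ext) auto
qed

section \<open>Size of the sampling set\<close>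

text \<open>
  Cutting the \<open>a\<close>-axis into strips of width \<open>2 * D\<close>: a point with \<open>2 * D * (k - 1) < a\<close> in the
  box of index \<open>r\<close> satisfies \<open>k \<le> M div r\<close>, hence \<open>r \<le> M div k\<close>.
\<close>

lemma sampling_set_subset_strips:
  "sampling_set M D \<subseteq> {0} \<times> {0..int (2 * M * D)} \<union>
    (\<Union>k\<in>{1..M}. {int (2 * D * (k - 1))<..int (2 * D * k)} \<times> {0..int (2 * D * (M div k))})"
proof (rule subsetI)
  fix s assume "s \<in> sampling_set M D"
  then obtain r a b where r: "1 \<le> r" "r \<le> M" and s: "s = (int a, int b)"
    and a: "a \<le> 2 * (M div r) * D" and b: "b \<le> 2 * r * D"
    by (auto simp: sampling_set_def init_seg_def simp del: of_nat_mult elim!: nonneg_int_cases)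
  show "s \<in> {0} \<times> {0..int (2 * M * D)} \<union>
    (\<Union>k\<in>{1..M}. {int (2 * D * (k - 1))<..int (2 * D * k)} \<times> {0..int (2 * D * (M div k))})"
  \<comment> \<open>The strips are open on the left, so the column \<open>a = 0\<close> is covered
    separately.\<close>
  proof (cases "a = 0")
    case True
    have "2 * r * D \<le> 2 * M * D" using r by (intro mult_le_mono) auto
    with b have "b \<le> 2 * M * D" by linarith
    with True s show ?thesis by (simp del: of_nat_mult)
  next
    case False
    with a have D: "D > 0" by (cases D) auto
    \<comment> \<open>This is \<open>a / (2 * D)\<close> rounded up.\<close>
    define k where "k = Suc ((a - 1) div (2 * D))"
    have "a - 1 < M div r * (2 * D)" using a False by (simp add: algebra_simps)
    then have k: "k \<le> M div r"
      using D by (simp add: k_def Suc_le_eq less_mult_imp_div_less)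
    \<comment> \<open>The hyperbola condition is symmetric in \<open>k\<close> and \<open>r\<close>,
      which turns the bound on the strip index into a bound on the height of the box.\<close>
    then have "k * r \<le> M" using r by (simp add: less_eq_div_iff_mult_less_eq)
    then have "r \<le> M div k" by (simp add: k_def less_eq_div_iff_mult_less_eq mult.commute)
    then have "2 * r * D \<le> 2 * D * (M div k)" by (simp add: algebra_simps)
    with b have "b \<le> 2 * D * (M div k)" by linarith
    moreover have "2 * D * (k - 1) < a" "a \<le> 2 * D * k"
    proof -
      have "2 * D * (k - 1) \<le> a - 1" by (simp add: k_def)
      with False show "2 * D * (k - 1) < a" by linarith
      have "a - 1 < 2 * D * k"
        using D dividend_less_times_div[of "2 * D" "a - 1"] by (simp add: k_def)
      then show "a \<le> 2 * D * k" by linarith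
    qed
    moreover have "k \<in> {1..M}"
      using le_trans[OF k div_le_dividend] by (simp add: k_def)
    ultimately show ?thesis unfolding s
      by (auto simp del: of_nat_mult)
  qed
qed

text \<open>Each strip has \<open>2 * D\<close> columns of height about
  \<open>2 * D * M / k\<close>, so summing over \<open>k\<close> produces a harmonic number.\<close>

lemma card_sampling_set_le:
  assumes "M \<ge> 1"
  shows "real (card (sampling_set M D)) \<le> 4 * M * D + 1 + 4 * D ^ 2 * M * (1 + ln M)"
proof -
  let ?strip = "\<lambda>k. {int (2 * D * (k - 1))<..int (2 * D * k)} \<times> {0..int (2 * D * (M div k))}"
  have "card (sampling_set M D) \<le> card (({0} \<times> {0..int (2 * M * D)}) \<union> (\<Union>k\<in>{1..M}. ?strip k))"
    by (intro card_mono sampling_set_subset_strips) simp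
  also have "\<dots> \<le> card ({0::int} \<times> {0..int (2 * M * D)}) + card (\<Union>k\<in>{1..M}. ?strip k)"
    by (rule card_Un_le)
  also have "\<dots> \<le> card ({0::int} \<times> {0..int (2 * M * D)}) + (\<Sum>k\<in>{1..M}. card (?strip k))"
    by (intro add_left_mono card_UN_le) simp
  also have "card ({0::int} \<times> {0..int (2 * M * D)}) = 2 * M * D + 1"
    by (simp add: card_cartesian_product nat_add_distrib nat_mult_distrib)
  also have "(\<Sum>k\<in>{1..M}. card (?strip k)) = (\<Sum>k\<in>{1..M}. 2 * D * (2 * D * (M div k) + 1))"
  proof (intro sum.cong refl)
    fix k assume "k \<in> {1..M}"
    then have "int (2 * D * k) - int (2 * D * (k - 1)) = int (2 * D)"
      by (cases k) (simp_all add: algebra_simps)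
    moreover have "int (2 * D * (M div k)) - 0 + 1 = int (2 * D * (M div k) + 1)" by simp
    ultimately show "card (?strip k) = 2 * D * (2 * D * (M div k) + 1)"
      by (simp only: card_cartesian_product card_greaterThanAtMost_int card_atLeastAtMost_int
            nat_int diff_0_right)
  qed
  finally have "real (card (sampling_set M D)) \<le>
      real (2 * M * D + 1 + (\<Sum>k\<in>{1..M}. 2 * D * (2 * D * (M div k) + 1)))"
    by (simp only: of_nat_le_iff)
  also have "\<dots> = 2 * M * D + 1 + (\<Sum>k\<in>{1..M}. 4 * D ^ 2 * real (M div k) + 2 * D)"
    by (simp add: algebra_simps power2_eq_square)
  also have "\<dots> \<le> 2 * M * D + 1 + (\<Sum>k\<in>{1..M}. 4 * D ^ 2 * (M * inverse k) + 2 * D)"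
    by (intro add_left_mono sum_mono add_right_mono mult_left_mono)
       (use of_nat_div_le_of_nat[where ?'a = real] in \<open>auto simp flip: divide_inverse\<close>)
  \<comment> \<open>The summand \<open>2 * D\<close>, taken \<open>M\<close> times, doubles the
    linear term.\<close>
  also have "\<dots> = 4 * M * D + 1 + 4 * D ^ 2 * M * harm M"
    by (simp add: harm_def sum.distrib sum_distrib_left algebra_simps)
  \<comment> \<open>\<open>harm n - ln n\<close> decreases from its value 1 at
    \<open>n = 1\<close>.\<close>
  also have "\<dots> \<le> 4 * M * D + 1 + 4 * D ^ 2 * M * (1 + ln M)"
    using euler_mascheroni_sequence_decreasing[of 1 M] assms
    by (intro add_left_mono mult_left_mono) (auto simp: harm_expand)
  finally show ?thesis by simp
qed

text \<open>For \<open>N \<ge> 2\<close> the logarithm is bounded away from 0, so all lower-order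
  terms can be absorbed into the main one.\<close>

lemma card_sampling_set_double_le:
  assumes "N \<ge> 2" "D \<ge> 1"
  shows "real (card (sampling_set (2 * N) D)) \<le> 50 * real D ^ 2 * real N * ln (real N)"
proof -
  have ln2: "1 \<le> 2 * ln (real N)"
  proof -
    have "ln 2 \<le> ln (real N)" using assms by simp
    with ln2_ge_two_thirds show ?thesis by linarith
  qed
  have DN: "real D * real N \<le> real D ^ 2 * real N"
    using assms by (intro mult_right_mono) (auto simp: power2_eq_square)
  have one: "1 \<le> real D ^ 2 * real N"
    using assms mult_mono[of 1 "real D ^ 2" 1 "real N"] by (simp add: one_le_power)
  have ln_double: "ln (real (2 * N)) \<le> 2 * ln (real N)"
    using assms ln_mono[of 2 "real N"] by (simp add: ln_mult)
  have "real (card (sampling_set (2 * N) D)) \<le>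
      8 * (real D * real N) + 1 + 8 * (real D ^ 2 * real N) * (1 + ln (real (2 * N)))"
    using card_sampling_set_le[of "2 * N" D] assms by (simp add: algebra_simps)
  also have "\<dots> \<le> 8 * (real D ^ 2 * real N) + real D ^ 2 * real N +
      8 * (real D ^ 2 * real N) * (1 + 2 * ln (real N))"
    using DN one ln_double by (intro add_mono mult_left_mono) auto
  also have "\<dots> = (real D ^ 2 * real N) * (17 + 16 * ln (real N))"
    by (simp add: algebra_simps)
  \<comment> \<open>\<open>1 \<le> 2 * ln N\<close> gives \<open>17 \<le> 34 * ln N\<close>, and
    \<open>34 + 16 = 50\<close>.\<close>
  also have "\<dots> \<le> (real D ^ 2 * real N) * (50 * ln (real N))"
    using ln2 by (intro mult_left_mono) auto
  finally show ?thesis by (simp add: algebra_simps)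
qed

theorem theorem2p1:
  "(\<forall>N D :: nat. N \<ge> 1 \<longrightarrow> D \<ge> 1 \<longrightarrow>
      (\<forall>f1 \<in> exp_polys N D. \<forall>f2 \<in> exp_polys N D.
         (\<forall>(a, b) \<in> sampling_set (2 * N) D.
            f1 (real_of_int a, real_of_int b) = f2 (real_of_int a, real_of_int b)) \<longrightarrow>
         f1 = f2)) \<and>
   (\<exists>C :: real. \<forall>N D :: nat. N \<ge> 2 \<longrightarrow> D \<ge> 1 \<longrightarrow>
      real (card (sampling_set (2 * N) D)) \<le> C * real D ^ 2 * real N * ln (real N))"
proof (intro conjI allI impI ballI)
  fix N D f1 f2
  assume "f1 \<in> exp_polys N D" "f2 \<in> exp_polys N D"
    and "\<forall>(a, b) \<in> sampling_set (2 * N) D.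
      f1 (real_of_int a, real_of_int b) = f2 (real_of_int a, real_of_int b)"
  then show "f1 = f2" by (intro exp_polys_determined[of f1 N D f2]) auto
next
  show "\<exists>C :: real. \<forall>N D :: nat. N \<ge> 2 \<longrightarrow> D \<ge> 1 \<longrightarrow>
      real (card (sampling_set (2 * N) D)) \<le> C * real D ^ 2 * real N * ln (real N)"
    using card_sampling_set_double_le by blast
qed

end
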